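(* Let $\mathcal{H}$ be a real Hilbert space, let $T:\mathcal{H}\to\mathcal{H}$ be a nonexpansive mapping such that $\operatorname{Fix}T\neq\emptyset$, let $\lambda:[0,+\infty)\to[0,1]$ be a Lebesgue measurable function and let $x_0\in\mathcal{H}$. Suppose that one of the following conditions is fulfilled: $$\int_0^{+\infty}\lambda(t)(1-\lambda(t))\,dt=+\infty\quad\text{or}\quad\inf_{t\ge0}\lambda(t)>0.$$ Let $x:[0,+\infty)\to\mathcal{H}$ be the unique strong global solution of $$\dot x(t)=\lambda(t)\big(T(x(t))-x(t)\big),\qquad x(0)=x_0.$$ Then the following statements are true: (i) the trajectory $x$ is bounded and $\int_0^{+\infty}\|\dot x(t)\|^2\,dt<+\infty$; (ii) $\lim_{t\to+\infty}\big(T(x(t))-x(t)\big)=0$ (strongly); (iii) $\lim_{t\to+\infty}\dot x(t)=0$ (strongly); (iv) $x(t)$ converges weakly to a point in $\operatorname{Fix}T$, as $t\to+\infty$.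
   Context: $T$ is nonexpansive if $\|Tx-Ty\|\le\|x-y\|$ for all $x,y\in\mathcal{H}$; $\operatorname{Fix}T=\{x\in\mathcal{H}:Tx=x\}$. A strong global solution of the system is a function $x:[0,+\infty)\to\mathcal{H}$ which is absolutely continuous on each interval $[0,b]$, $0<b<+\infty$ (i.e. on $[0,b]$ it is the sum of a constant and the indefinite integral of an integrable $\mathcal{H}$-valued function), satisfies $\dot x(t)=\lambda(t)\big(T(x(t))-x(t)\big)$ for almost all $t\ge0$, and satisfies $x(0)=x_0$. Such a solution exists and is unique. The derivative $\dot x(t)$ exists for almost all $t\ge 0$; statements about $\dot x(t)$ are understood for those $t$ at which the derivative exists. *)

theory Defs
  imports "HOL-Analysis.Analysis"
begin

definition nonexpansive :: "('a::real_normed_vector \<Rightarrow> 'a) \<Rightarrow> bool" where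
  "nonexpansive T \<longleftrightarrow> (\<forall>x y. norm (T x - T y) \<le> norm (x - y))"

definition Fix :: "('a \<Rightarrow> 'a) \<Rightarrow> 'a set" where
  "Fix T = {x. T x = x}"

text \<open>
  The library's \<^const>\<open>has_bochner_integral\<close> is available only for second-countable codomains, which
  would restrict Hilbert spaces to separable ones. The following is the same definition without
  that sort constraint. The approximation by simple functions forces \<open>f\<close> to be almost everywhere
  separably valued, so this is the Bochner integral also in nonseparable spaces.
\<close>
definition bochner_integral_is :: "'b measure \<Rightarrow> ('b \<Rightarrow> 'a::real_normed_vector) \<Rightarrow> 'a \<Rightarrow> bool" where
  "bochner_integral_is M f I \<longleftrightarrow>
     f \<in> borel_measurable M \<and>
     (\<exists>s :: nat \<Rightarrow> 'b \<Rightarrow> 'a.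
        (\<forall>i. Bochner_Integration.simple_bochner_integrable M (s i)) \<and>
        (\<lambda>i. \<integral>\<^sup>+t. ennreal (norm (f t - s i t)) \<partial>M) \<longlonglongrightarrow> 0 \<and>
        (\<lambda>i. Bochner_Integration.simple_bochner_integral M (s i)) \<longlonglongrightarrow> I)"

lemma bochner_integral_is_iff_has_bochner_integral:
  fixes f :: "'b \<Rightarrow> 'a::{real_normed_vector, second_countable_topology}"
  shows "bochner_integral_is M f I \<longleftrightarrow> has_bochner_integral M f I"
  unfolding bochner_integral_is_def has_bochner_integral.simps by blast

text \<open>
  A constant plus an indefinite Bochner integral; the instance \<open>t = b\<close> says that \<open>g\<close> is
  integrable on the whole interval.
\<close>
definition absolutely_continuous_on_Icc ::
    "real \<Rightarrow> real \<Rightarrow> (real \<Rightarrow> 'a::real_normed_vector) \<Rightarrow> bool" where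
  "absolutely_continuous_on_Icc a b x \<longleftrightarrow>
     (\<exists>c g. \<forall>t\<in>{a..b}. bochner_integral_is (lebesgue_on {a..t}) g (x t - c))"

text \<open>
  Trajectories are functions on the whole real line of which only the values on \<open>{0..}\<close> matter;
  derivatives are therefore taken within \<open>{0..}\<close>.
\<close>
definition strong_global_solution ::
    "('a::real_normed_vector \<Rightarrow> 'a) \<Rightarrow> (real \<Rightarrow> real) \<Rightarrow> 'a \<Rightarrow> (real \<Rightarrow> 'a) \<Rightarrow> bool" where
  "strong_global_solution T l x0 x \<longleftrightarrow>
     (\<forall>b>0. absolutely_continuous_on_Icc 0 b x) \<and>
     (AE t in lebesgue. 0 \<le> t \<longrightarrow>
        (x has_vector_derivative l t *\<^sub>R (T (x t) - x t)) (at t within {0..})) \<and>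
     x 0 = x0"

definition weakly_tendsto ::
    "('b \<Rightarrow> 'a::real_normed_vector) \<Rightarrow> 'a \<Rightarrow> 'b filter \<Rightarrow> bool" where
  "weakly_tendsto x p F \<longleftrightarrow>
     (\<forall>\<phi> :: 'a \<Rightarrow> real. bounded_linear \<phi> \<longrightarrow> ((\<lambda>t. \<phi> (x t)) \<longlongrightarrow> \<phi> p) F)"

end

theory Submission
  imports Defs
begin

text \<open>
  For a fixed point \<open>y\<close>, nonexpansiveness gives \<open>2 \<langle>T x - x, x - y\<rangle> \<le> - \<parallel>T x - x\<parallel>\<^sup>2\<close>, so
  \<open>\<parallel>x(t) - y\<parallel>\<^sup>2\<close> decreases at rate at least \<open>\<lambda> \<parallel>T x - x\<parallel>\<^sup>2\<close>, which is therefore integrable. Either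
  hypothesis on \<open>\<lambda>\<close> makes \<open>\<integral>\<lambda>\<close> infinite; as the residual \<open>\<parallel>T x - x\<parallel>\<close> is nonincreasing,
  it tends to \<open>0\<close>; since it bounds \<open>\<parallel>x'\<parallel>\<close>, so does the derivative. Weak convergence follows
  without weak compactness, from asymptotic centres: every asymptotic centre of the trajectory, along
  any subfilter, is a fixed point, and on fixed points all asymptotic radii agree, so all these centres
  coincide; a functional that stays away from its limit along a subfilter would move the centre.
\<close>

subsection \<open>Differential inequalities for absolutely continuous functions\<close>

text \<open>One simple function \<open>s i\<close> at integral distance below 1 suffices:
  \<open>norm (f t)\<close> is \<open>norm (s i t)\<close> plus a difference dominated by
  \<open>norm (f t - s i t)\<close>, and both summands are real-valued and integrable.\<close>

lemma bochner_integral_is_integrable_norm: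
  assumes "bochner_integral_is M f I"
  shows "integrable M (\<lambda>t. norm (f t))"
proof -
  obtain s where f: "f \<in> borel_measurable M"
    and s: "\<And>i. Bochner_Integration.simple_bochner_integrable M (s i)"
    and lim: "(\<lambda>i. \<integral>\<^sup>+t. ennreal (norm (f t - s i t)) \<partial>M) \<longlonglongrightarrow> 0"
    using assms unfolding bochner_integral_is_def by blast
  have "\<forall>\<^sub>F i in sequentially. (\<integral>\<^sup>+t. ennreal (norm (f t - s i t)) \<partial>M) < 1"
    using lim by (rule order_tendstoD) simp
  then obtain i where i: "(\<integral>\<^sup>+t. ennreal (norm (f t - s i t)) \<partial>M) < 1"
    using eventually_happens by fastforce
  have f': "(\<lambda>t. norm (f t)) \<in> borel_measurable M"
    using f by (rule measurable_compose) (simp add: borel_measurable_continuous_onI continuous_on_norm_id)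
  have "Bochner_Integration.simple_bochner_integrable M (\<lambda>t. norm (s i t))"
    using simple_bochner_integrable_compose2[of "\<lambda>x y. norm x", OF _ s s] by simp
  then have s': "integrable M (\<lambda>t. norm (s i t))"
    using has_bochner_integral_simple_bochner_integrable integrable.intros by blast
  have "integrable M (\<lambda>t. norm (f t) - norm (s i t))"
  proof (rule integrableI_bounded)
    show "(\<lambda>t. norm (f t) - norm (s i t)) \<in> borel_measurable M"
      using f' s' by measurable
    have "(\<integral>\<^sup>+t. ennreal (norm (norm (f t) - norm (s i t))) \<partial>M)
        \<le> (\<integral>\<^sup>+t. ennreal (norm (f t - s i t)) \<partial>M)"
      by (intro nn_integral_mono ennreal_leI) (simp add: norm_triangle_ineq3)
    also have "\<dots> < \<infinity>"
      using i by (rule less_trans) simp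
    finally show "(\<integral>\<^sup>+t. ennreal (norm (norm (f t) - norm (s i t))) \<partial>M) < \<infinity>" .
  qed
  from Bochner_Integration.integrable_add[OF this s'] show ?thesis by simp
qed

text \<open>The functional maps the approximating simple functions to real ones and does not
  increase their distance to the limit. Testing against unit vectors thus moves vector integrals
  into the real-valued theory.\<close>

lemma bochner_integral_is_functional:
  fixes \<phi> :: "'a::real_normed_vector \<Rightarrow> real"
  assumes "bochner_integral_is M f I" and \<phi>: "linear \<phi>" and le: "\<And>y. \<bar>\<phi> y\<bar> \<le> norm y"
  shows "has_bochner_integral M (\<lambda>t. \<phi> (f t)) (\<phi> I)"
proof -
  interpret linear \<phi> by fact
  have bl: "bounded_linear \<phi>"
    by (rule bounded_linear_intro[where K=1]) (simp_all add: add scale le)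
  obtain s where f: "f \<in> borel_measurable M"
    and s: "\<And>i. Bochner_Integration.simple_bochner_integrable M (s i)"
    and lim: "(\<lambda>i. \<integral>\<^sup>+t. ennreal (norm (f t - s i t)) \<partial>M) \<longlonglongrightarrow> 0"
    and limI: "(\<lambda>i. Bochner_Integration.simple_bochner_integral M (s i)) \<longlonglongrightarrow> I"
    using assms unfolding bochner_integral_is_def by blast
  show ?thesis
  proof (rule has_bochner_integral.intros)
    show "(\<lambda>t. \<phi> (f t)) \<in> borel_measurable M"
      using f by (rule measurable_compose)
        (intro borel_measurable_continuous_onI bounded_linear.continuous_on[OF bl] continuous_on_id)
    show "\<And>i. Bochner_Integration.simple_bochner_integrable M (\<lambda>t. \<phi> (s i t))"
      using simple_bochner_integrable_compose2[of "\<lambda>x y. \<phi> x", OF _ s s] zero by simp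
    show "(\<lambda>i. \<integral>\<^sup>+t. ennreal (norm (\<phi> (f t) - \<phi> (s i t))) \<partial>M) \<longlonglongrightarrow> 0"
    proof (rule tendsto_sandwich[OF _ _ tendsto_const lim])
      show "\<forall>\<^sub>F i in sequentially. (\<integral>\<^sup>+t. ennreal (norm (\<phi> (f t) - \<phi> (s i t))) \<partial>M)
          \<le> (\<integral>\<^sup>+t. ennreal (norm (f t - s i t)) \<partial>M)"
        using le by (intro always_eventually allI nn_integral_mono ennreal_leI) (simp flip: diff)
    qed simp
    show "(\<lambda>i. Bochner_Integration.simple_bochner_integral M (\<lambda>t. \<phi> (s i t))) \<longlonglongrightarrow> \<phi> I"
      using bounded_linear.tendsto[OF bl limI]
      by (simp add: simple_bochner_integral_linear[OF \<phi> s])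
  qed
qed

text \<open>For \<open>a \<le> b\<close>, \<open>G\<close> is the norm of the density; the bound on
  an increment comes from testing the integral against a single direction.\<close>

lemma absolutely_continuous_on_Icc_increment:
  fixes x :: "real \<Rightarrow> 'a::real_inner"
  assumes "absolutely_continuous_on_Icc a b x"
  obtains G where "G integrable_on {a..b}" and "\<And>t. 0 \<le> G t"
    and "\<And>s t. a \<le> s \<Longrightarrow> s \<le> t \<Longrightarrow> t \<le> b \<Longrightarrow> norm (x t - x s) \<le> integral {s..t} G"
proof (cases "a \<le> b")
  case True
  obtain c g where g: "\<And>t. t \<in> {a..b} \<Longrightarrow> bochner_integral_is (lebesgue_on {a..t}) g (x t - c)"
    using assms unfolding absolutely_continuous_on_Icc_def by blast
  show thesis
  proof
    show G: "(\<lambda>t. norm (g t)) integrable_on {a..b}"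
      using bochner_integral_is_integrable_norm[OF g[of b]] True
      by (intro integrable_on_lebesgue_on) auto
    show "0 \<le> norm (g t)" for t by simp
    show "norm (x t - x s) \<le> integral {s..t} (\<lambda>t. norm (g t))"
      if st: "a \<le> s" "s \<le> t" "t \<le> b" for s t
    proof (cases "x t = x s")
      case False
      \<comment> \<open>The unit vector along the increment: its inner product with
        \<open>x t - x s\<close> is the norm to be bounded.\<close>
      define v where "v = sgn (x t - x s)"
      have v: "norm v = 1" using False by (simp add: v_def norm_sgn)
      have lin: "linear (\<lambda>y. v \<bullet> y)" by (simp add: bounded_linear.linear bounded_linear_inner_right)
      have le: "\<bar>v \<bullet> y\<bar> \<le> norm y" for y
        using Cauchy_Schwarz_ineq2[of v y] v by simp
      have int: "((\<lambda>r. v \<bullet> g r) has_integral v \<bullet> (x r - c)) {a..r}" if "r \<in> {a..b}" for r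
        using has_integral_integral_lebesgue_on[of "{a..r}" "\<lambda>r. v \<bullet> g r"]
          bochner_integral_is_functional[OF g[OF that] lin le]
        by (auto simp: has_bochner_integral_iff)
      have int_st: "(\<lambda>r. v \<bullet> g r) integrable_on {s..t}"
        using int[of t] st by (meson atLeastAtMost_iff has_integral_integrable
          integrable_on_subinterval order.trans atLeastatMost_subset_iff order.refl)
      have "integral {a..s} (\<lambda>r. v \<bullet> g r) + integral {s..t} (\<lambda>r. v \<bullet> g r)
          = integral {a..t} (\<lambda>r. v \<bullet> g r)"
        using int[of t] st by (intro Henstock_Kurzweil_Integration.integral_combine) auto
      then have "v \<bullet> (x s - c) + integral {s..t} (\<lambda>r. v \<bullet> g r) = v \<bullet> (x t - c)"
        using int[of s] int[of t] st by (simp add: integral_unique)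
      then have "v \<bullet> (x t - x s) = integral {s..t} (\<lambda>r. v \<bullet> g r)"
        by (simp add: inner_diff_right)
      also have "\<dots> \<le> integral {s..t} (\<lambda>t. norm (g t))"
      proof (rule integral_le[OF int_st])
        show "(\<lambda>t. norm (g t)) integrable_on {s..t}"
          using integrable_on_subinterval[OF G] st by auto
        show "v \<bullet> g r \<le> norm (g r)" for r
          using le[of "g r"] by linarith
      qed
      finally show ?thesis
        using False by (simp add: v_def sgn_div_norm dot_square_norm power2_eq_square flip: mult.assoc)
    qed (simp add: integral_nonneg integrable_on_subinterval[OF G] st)
  qed
next
  case False
  \<comment> \<open>When \<open>b < a\<close> there are no \<open>s\<close>, \<open>t\<close> to
    compare, and the zero function will do.\<close>
  then show thesis by (intro that[of "\<lambda>_. 0"]) auto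
qed

text \<open>
  On the exceptional null set the increments are bounded by \<open>\<integral> G\<close>; applying Henstock's lemma to \<open>G\<close>
  set to zero on \<open>N\<close> shows that the cells tagged in \<open>N\<close> contribute arbitrarily little.
\<close>
lemma increment_le_integral:
  fixes F f G :: "real \<Rightarrow> real"
  assumes "a \<le> b" and N: "negligible N"
    and G: "G integrable_on {a..b}" and f: "f integrable_on {a..b}"
    and inc: "\<And>s t. a \<le> s \<Longrightarrow> s \<le> t \<Longrightarrow> t \<le> b \<Longrightarrow> F t - F s \<le> integral {s..t} G"
    and der: "\<And>t e. t \<in> {a..b} - N \<Longrightarrow> 0 < e \<Longrightarrow>
      \<exists>d>0. \<forall>r s. a \<le> r \<and> r \<le> t \<and> t \<le> s \<and> s \<le> b \<and> t - r < d \<and> s - t < d \<longrightarrow>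
        F s - F r \<le> (f t + e) * (s - r)"
  shows "F b - F a \<le> integral {a..b} f"
proof (rule field_le_epsilon)
  fix e :: real
  assume "0 < e"
  \<comment> \<open>The budget \<open>e\<close> is spent as \<open>\<eta> * (b - a)\<close> on the
    pointwise derivative estimates and one \<open>\<eta>\<close> each on the Riemann sum of
    \<open>f0\<close> and the Henstock sum of \<open>G0\<close>.\<close>
  define \<eta> where "\<eta> = e / (b - a + 2)"
  have \<eta>: "0 < \<eta>" "\<eta> * (b - a + 2) = e"
    using \<open>0 < e\<close> \<open>a \<le> b\<close> by (auto simp: \<eta>_def)
  define G0 where "G0 t = (if t \<in> N then 0 else G t)" for t
  define f0 where "f0 t = (if t \<in> N then 0 else f t)" for t
  have G0: "G0 integrable_on {a..b}"
    by (rule integrable_spike[OF G N]) (simp add: G0_def)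
  have f0: "f0 integrable_on {a..b}"
    by (rule integrable_spike[OF f N]) (simp add: f0_def)
  have G0_eq: "integral S G0 = integral S G" for S
    by (rule integral_spike[OF N]) (simp add: G0_def)
  have f0_eq: "integral {a..b} f0 = integral {a..b} f"
    by (rule integral_spike[OF N]) (simp add: f0_def)
  obtain \<gamma>1 where \<gamma>1: "gauge \<gamma>1"
    "\<And>p. \<lbrakk>p tagged_partial_division_of (cbox a b); \<gamma>1 fine p\<rbrakk> \<Longrightarrow>
       sum (\<lambda>(t,K). norm (measure lborel K *\<^sub>R G0 t - integral K G0)) p < \<eta>"
    using Henstock_lemma[of G0 a b \<eta>] G0 \<eta> by auto
  obtain \<gamma>2 where \<gamma>2: "gauge \<gamma>2"
    "\<And>p. \<lbrakk>p tagged_division_of {a..b}; \<gamma>2 fine p\<rbrakk> \<Longrightarrow>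
       norm (sum (\<lambda>(t,K). measure lborel K *\<^sub>R f0 t) p - integral {a..b} f0) < \<eta>"
    using integrable_integral[OF f0] \<eta>(1) unfolding has_integral_real by metis
  \<comment> \<open>The condition on \<open>t\<close> stands inside the quantifier so that
    \<open>d t\<close> is positive at every \<open>t\<close>, as a gauge demands.\<close>
  have "\<exists>d>0. t \<in> {a..b} - N \<longrightarrow>
      (\<forall>r s. a \<le> r \<and> r \<le> t \<and> t \<le> s \<and> s \<le> b \<and> t - r < d \<and> s - t < d \<longrightarrow>
        F s - F r \<le> (f t + \<eta>) * (s - r))" for t
    using der[of t \<eta>] \<eta>(1) zero_less_one by blast
  then obtain d where d: "\<And>t. 0 < d t"
    "\<And>t r s. t \<in> {a..b} - N \<Longrightarrow> a \<le> r \<Longrightarrow> r \<le> t \<Longrightarrow> t \<le> s \<Longrightarrow> s \<le> b \<Longrightarrow>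
       t - r < d t \<Longrightarrow> s - t < d t \<Longrightarrow> F s - F r \<le> (f t + \<eta>) * (s - r)"
    by metis
  have "gauge (\<lambda>t. \<gamma>1 t \<inter> \<gamma>2 t \<inter> ball t (d t))"
    using \<gamma>1(1) \<gamma>2(1) d(1) by (intro gauge_Int) (auto simp: gauge_def)
  then obtain p where p: "p tagged_division_of {a..b}"
    and fine: "(\<lambda>t. \<gamma>1 t \<inter> \<gamma>2 t \<inter> ball t (d t)) fine p"
    by (rule fine_division_exists_real)
  have fine1: "\<gamma>1 fine p" and fine2: "\<gamma>2 fine p" and fine3: "(\<lambda>t. ball t (d t)) fine p"
    using fine by (auto simp: fine_def)
  have "F b - F a = (\<Sum>(t,K)\<in>p. F (Sup K) - F (Inf K))"
    using additive_tagged_division_1[OF \<open>a \<le> b\<close> p, of F] by simp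
  also have "\<dots> \<le> (\<Sum>(t,K)\<in>p. measure lborel K *\<^sub>R f0 t + \<eta> * measure lborel K
      + norm (measure lborel K *\<^sub>R G0 t - integral K G0))"
  proof (rule sum_mono, clarify)
    fix t K
    assume tK: "(t, K) \<in> p"
    then obtain r s where K: "K = {r..s}"
      using tagged_division_ofD(4)[OF p] by (metis box_real(2))
    have "t \<in> K" "K \<subseteq> {a..b}" and ball: "K \<subseteq> ball t (d t)"
      using tagged_division_ofD(2,3)[OF p tK] fine3 tK by (auto simp: fine_def)
    then have le: "a \<le> r" "r \<le> t" "t \<le> s" "s \<le> b" and "r \<in> K" "s \<in> K"
      unfolding K by auto
    with ball have near: "t - r < d t" "s - t < d t"
      by (auto simp: subset_iff dist_real_def)
    have sup: "Sup K = s" "Inf K = r" "measure lborel K = s - r"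
      using le unfolding K by auto
    show "F (Sup K) - F (Inf K) \<le> measure lborel K *\<^sub>R f0 t + \<eta> * measure lborel K
        + norm (measure lborel K *\<^sub>R G0 t - integral K G0)"
    proof (cases "t \<in> N")
      \<comment> \<open>Here \<open>f0 t\<close> and \<open>G0 t\<close> vanish, so the Henstock
        term is exactly \<open>\<bar>integral K G0\<bar>\<close>, and \<open>G0\<close> has the same
        integral as \<open>G\<close>.\<close>
      case True
      have "F s - F r \<le> \<bar>integral K G0\<bar>"
        using inc[of r s] le by (simp add: G0_eq K)
      moreover have "0 \<le> \<eta> * (s - r)"
        using \<eta>(1) le by simp
      ultimately show ?thesis
        using True by (simp add: sup f0_def G0_def)
    next
      case False
      then have "F s - F r \<le> (f t + \<eta>) * (s - r)"
        using d(2)[of t r s] le near by auto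
      with False show ?thesis
        by (simp add: sup f0_def algebra_simps)
    qed
  qed
  also have "\<dots> = (\<Sum>(t,K)\<in>p. measure lborel K *\<^sub>R f0 t) + \<eta> * (\<Sum>(t,K)\<in>p. measure lborel K)
      + (\<Sum>(t,K)\<in>p. norm (measure lborel K *\<^sub>R G0 t - integral K G0))"
    by (simp add: sum.distrib split_def sum_distrib_left)
  also have "\<dots> \<le> (integral {a..b} f + \<eta>) + \<eta> * (b - a) + \<eta>"
  proof (intro add_mono)
    show "(\<Sum>(t,K)\<in>p. measure lborel K *\<^sub>R f0 t) \<le> integral {a..b} f + \<eta>"
      using \<gamma>2(2)[OF p fine2] by (simp add: f0_eq abs_diff_less_iff)
    show "\<eta> * (\<Sum>(t,K)\<in>p. measure lborel K) \<le> \<eta> * (b - a)"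
      using additive_content_tagged_division[of p a b] p \<open>a \<le> b\<close> by simp
    show "(\<Sum>(t,K)\<in>p. norm (measure lborel K *\<^sub>R G0 t - integral K G0)) \<le> \<eta>"
      using \<gamma>1(2)[OF _ fine1] p by (simp add: tagged_division_of_def less_imp_le)
  qed
  also have "\<dots> = integral {a..b} f + e"
    using \<eta>(2) by (simp add: algebra_simps)
  finally show "F b - F a \<le> integral {a..b} f + e" .
qed

text \<open>The indefinite integral of \<open>G\<close> is continuous, and distances between values
  of \<open>x\<close> never exceed those between its values.\<close>

lemma continuous_on_increment_bound:
  fixes x :: "real \<Rightarrow> 'a::real_normed_vector"
  assumes G: "G integrable_on {a..b}"
    and inc: "\<And>s t. a \<le> s \<Longrightarrow> s \<le> t \<Longrightarrow> t \<le> b \<Longrightarrow> norm (x t - x s) \<le> integral {s..t} G"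
  shows "continuous_on {a..b} x"
proof -
  define I where "I t = integral {a..t} G" for t
  have I: "continuous_on {a..b} I"
    unfolding I_def by (rule indefinite_integral_continuous_1[OF G])
  have le: "norm (x t - x s) \<le> I t - I s" if "a \<le> s" "s \<le> t" "t \<le> b" for s t
  proof -
    have "I s + integral {s..t} G = I t"
      unfolding I_def using that
      by (intro Henstock_Kurzweil_Integration.integral_combine integrable_on_subinterval[OF G]) auto
    then show ?thesis using inc[OF that] by simp
  qed
  have "dist (x t) (x s) \<le> dist (I t) (I s)" if "s \<in> {a..b}" "t \<in> {a..b}" for s t
    using le[of s t] le[of t s] that
    by (cases "s \<le> t") (auto simp: dist_norm norm_minus_commute)
  then show ?thesis
    using I unfolding continuous_on_iff by (meson le_less_trans)
qed

text \<open>The errors on the two sides of \<open>t\<close> add up without loss, because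
  \<open>(s - t) + (t - r) = s - r\<close>. Both sides occur, since the tag of a cell may lie
  anywhere in it.\<close>

lemma vector_derivative_straddle:
  assumes der: "(x has_vector_derivative D) (at t within S)" and "t \<in> S" "0 < e"
  obtains d where "0 < d"
    "\<And>r s. r \<in> S \<Longrightarrow> s \<in> S \<Longrightarrow> r \<le> t \<Longrightarrow> t \<le> s \<Longrightarrow> t - r < d \<Longrightarrow> s - t < d \<Longrightarrow>
       norm (x s - x r - (s - r) *\<^sub>R D) \<le> e * (s - r)"
proof -
  obtain d where d: "0 < d"
    "\<And>s. s \<in> S \<Longrightarrow> norm (s - t) < d \<Longrightarrow> norm (x s - x t - (s - t) *\<^sub>R D) \<le> e * norm (s - t)"
    using der \<open>0 < e\<close> unfolding has_vector_derivative_def has_derivative_within_alt by blast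
  have "norm (x s - x r - (s - r) *\<^sub>R D) \<le> e * (s - r)"
    if "r \<in> S" "s \<in> S" "r \<le> t" "t \<le> s" "t - r < d" "s - t < d" for r s
  proof -
    have "x s - x r - (s - r) *\<^sub>R D = (x s - x t - (s - t) *\<^sub>R D) - (x r - x t - (r - t) *\<^sub>R D)"
      by (simp add: algebra_simps)
    also have "norm \<dots> \<le> norm (x s - x t - (s - t) *\<^sub>R D) + norm (x r - x t - (r - t) *\<^sub>R D)"
      by (rule norm_triangle_ineq4)
    also have "\<dots> \<le> e * (s - t) + e * (t - r)"
      using d(2)[of s] d(2)[of r] that by (intro add_mono) auto
    finally show ?thesis by (simp add: algebra_simps)
  qed
  with d(1) show thesis by (rule that)
qed

subsection \<open>Asymptotic centres and weak convergence\<close>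

text \<open>The quadratic gap at midpoints makes every minimizing sequence Cauchy, and completeness
  supplies the minimizer. This serves both for Riesz representation and for asymptotic
  centres.\<close>

lemma midpoint_convex_minimizer:
  fixes Q :: "'a::{real_inner, complete_space} \<Rightarrow> real"
  assumes cont: "continuous_on UNIV Q" and lower: "\<And>z. m0 \<le> Q z"
    and mid: "\<And>z w. Q ((1/2) *\<^sub>R (z + w)) \<le> (Q z + Q w) / 2 - (norm (z - w))\<^sup>2 / 4"
  obtains z where "\<And>w. Q z + (norm (z - w))\<^sup>2 / 2 \<le> Q w"
proof -
  define m where "m = Inf (range Q)"
  have bdd: "bdd_below (range Q)"
    using lower by (auto intro!: bdd_belowI[of _ m0])
  have m: "m \<le> Q z" for z
    unfolding m_def using bdd by (rule cInf_lower[rotated]) simp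
  have "\<exists>z. Q z < m + 1 / real (Suc n)" for n
    using cInf_lessD[of "range Q" "m + 1 / real (Suc n)"] by (auto simp: m_def)
  then obtain Z where Z: "\<And>n. Q (Z n) < m + 1 / real (Suc n)"
    by metis
  have gap: "(norm (z - w))\<^sup>2 \<le> 2 * (Q z - m) + 2 * (Q w - m)" for z w
    using mid[of z w] m[of "(1/2) *\<^sub>R (z + w)"] by (simp add: field_simps)
  have Cauchy: "Cauchy Z"
  proof (rule metric_CauchyI)
    fix e :: real
    assume "0 < e"
    \<comment> \<open>By \<open>gap\<close>, two excesses over the infimum that are below
      \<open>d\<close> give a squared distance below \<open>4 * d\<close>.\<close>
    define d where "d = e\<^sup>2 / 4"
    have d: "0 < d" "e\<^sup>2 = 4 * d" using \<open>0 < e\<close> by (auto simp: d_def)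
    then obtain N where N: "1 / real (Suc N) < d"
      using nat_approx_posE by metis
    have "dist (Z i) (Z j) < e" if "N \<le> i" "N \<le> j" for i j
    proof -
      have *: "Q (Z k) - m < d" if "N \<le> k" for k
      proof -
        have "1 / real (Suc k) \<le> 1 / real (Suc N)"
          using that by (simp add: frac_le)
        then show ?thesis using Z[of k] N by linarith
      qed
      have "(norm (Z i - Z j))\<^sup>2 < e\<^sup>2"
        using gap[of "Z i" "Z j"] *[OF that(1)] *[OF that(2)] by (simp add: d(2))
      then show ?thesis
        using \<open>0 < e\<close> by (simp add: dist_norm power2_less_imp_less)
    qed
    then show "\<exists>M. \<forall>i\<ge>M. \<forall>j\<ge>M. dist (Z i) (Z j) < e" by blast
  qed
  then obtain z where z: "Z \<longlonglongrightarrow> z"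
    using Cauchy_convergent convergentD by blast
  have "(\<lambda>n. Q (Z n)) \<longlonglongrightarrow> Q z"
    using continuous_on_tendsto_compose[OF cont z] by simp
  moreover have "(\<lambda>n. m + 1 / real (Suc n)) \<longlonglongrightarrow> m"
    using LIMSEQ_inverse_real_of_nat_add[of m] by (simp add: inverse_eq_divide)
  ultimately have "Q z \<le> m"
    by (rule LIMSEQ_le) (use Z less_imp_le in blast)
  have "Q z + (norm (z - w))\<^sup>2 / 2 \<le> Q w" for w
    using mid[of z w] m[of "(1/2) *\<^sub>R (z + w)"] \<open>Q z \<le> m\<close> by (simp add: field_simps)
  then show thesis by (rule that)
qed

section \<open>The parallelogram identity and Riesz representation\<close>

lemma norm_midpoint_sq:
  fixes u v :: "'a::real_inner"
  shows "(norm ((1/2) *\<^sub>R (u + v)))\<^sup>2 = ((norm u)\<^sup>2 + (norm v)\<^sup>2) / 2 - (norm (u - v))\<^sup>2 / 4"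
  unfolding power2_norm_eq_inner
  by (simp add: inner_add_left inner_add_right inner_diff_left inner_diff_right
      inner_commute[of v u] field_simps)

text \<open>The representing vector minimizes \<open>(norm v)\<^sup>2 - 2 * \<phi> v\<close>;
  vanishing of the first variation in direction \<open>w\<close> is the claim.\<close>

lemma riesz_representation:
  fixes \<phi> :: "'a::{real_inner, complete_space} \<Rightarrow> real"
  assumes "bounded_linear \<phi>"
  obtains v where "\<And>w. \<phi> w = v \<bullet> w"
proof -
  interpret bounded_linear \<phi> by fact
  obtain K where K: "\<And>y. norm (\<phi> y) \<le> norm y * K"
    using bounded by blast
  define Q where "Q v = (norm v)\<^sup>2 - 2 * \<phi> v" for v
  obtain v where v: "\<And>w. Q v + (norm (v - w))\<^sup>2 / 2 \<le> Q w"
  proof (rule midpoint_convex_minimizer[of Q "- K\<^sup>2"])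
    show "continuous_on UNIV Q"
      unfolding Q_def by (intro continuous_intros continuous_on)
    show "- K\<^sup>2 \<le> Q z" for z
    proof -
      \<comment> \<open>Completing the square: \<open>r\<^sup>2 - 2 * K * r\<close> is never below
        \<open>- K\<^sup>2\<close>.\<close>
      have "0 \<le> (norm z - K)\<^sup>2" by simp
      then show ?thesis
        using K[of z] by (simp add: Q_def power2_eq_square algebra_simps)
    qed
    show "Q ((1/2) *\<^sub>R (z + w)) \<le> (Q z + Q w) / 2 - (norm (z - w))\<^sup>2 / 4" for z w
      unfolding Q_def norm_midpoint_sq scale add by (simp add: field_simps)
  qed (rule that)
  have "\<phi> w = v \<bullet> w" for w
  proof -
    \<comment> \<open>The defect \<open>c\<close> is half the slope of \<open>Q\<close> at
      \<open>v\<close> in direction \<open>w\<close>. The quadratic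
      \<open>2 * s * c + s\<^sup>2 * n\<close> attains its minimum \<open>- c\<^sup>2 / n\<close> at
      the \<open>s\<close> chosen below; the 1 in \<open>n\<close> covers
      \<open>w = 0\<close>.\<close>
    define c where "c = v \<bullet> w - \<phi> w"
    define n where "n = (norm w)\<^sup>2 + 1"
    have n: "0 < n" by (simp add: n_def add_nonneg_pos)
    define s where "s = - c / n"
    have "Q v \<le> Q (v + s *\<^sub>R w)"
      using v[of "v + s *\<^sub>R w"] zero_le_power2[of "norm (v - (v + s *\<^sub>R w))"] by linarith
    then have "0 \<le> 2 * s * c + s\<^sup>2 * (norm w)\<^sup>2"
      unfolding Q_def c_def power2_norm_eq_inner
      by (simp add: inner_add_left inner_add_right inner_commute[of w v] add scale
          power2_eq_square algebra_simps)
    also have "\<dots> \<le> 2 * s * c + s\<^sup>2 * n"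
      by (simp add: n_def mult_left_mono)
    also have "\<dots> = - (c\<^sup>2 / n)"
      using n by (simp add: s_def power2_eq_square field_simps)
    finally have "c\<^sup>2 / n \<le> 0" by simp
    then have "c = 0"
      using n by (simp add: divide_le_0_iff)
    then show ?thesis by (simp add: c_def)
  qed
  then show thesis by (rule that)
qed

section \<open>Asymptotic radii along a filter\<close>

text \<open>This is the limit superior of \<open>norm (x t - z)\<close> along \<open>F\<close>,
  written as the infimum of the eventual upper bounds. For a nontrivial filter and eventually
  bounded \<open>x\<close> that set is nonempty and bounded below by 0.\<close>

definition asymptotic_radius :: "'b filter \<Rightarrow> ('b \<Rightarrow> 'a::real_normed_vector) \<Rightarrow> 'a \<Rightarrow> real" where
  "asymptotic_radius F x z = Inf {c. \<forall>\<^sub>F t in F. norm (x t - z) \<le> c}"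

context
  fixes F :: "'b filter" and x :: "'b \<Rightarrow> 'a::real_normed_vector" and B :: real
  assumes nontriv: "F \<noteq> bot" and bounded_x: "\<forall>\<^sub>F t in F. norm (x t) \<le> B"
begin

lemma eventually_bound_nonneg: "0 \<le> c" if ev: "\<forall>\<^sub>F t in F. norm (x t - z) \<le> c"
proof -
  obtain t where "norm (x t - z) \<le> c"
    using eventually_happens[OF ev] nontriv by blast
  then show ?thesis by (rule order.trans[OF norm_ge_zero])
qed

lemma asymptotic_radius_le: "asymptotic_radius F x z \<le> c" if "\<forall>\<^sub>F t in F. norm (x t - z) \<le> c"
  unfolding asymptotic_radius_def
  using that eventually_bound_nonneg by (intro cInf_lower) (auto intro!: bdd_belowI[of _ 0])

lemma bound_set_nonempty: "{c. \<forall>\<^sub>F t in F. norm (x t - z) \<le> c} \<noteq> {}"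
proof -
  have "\<forall>\<^sub>F t in F. norm (x t - z) \<le> B + norm z"
    using bounded_x by eventually_elim (meson add_right_mono norm_triangle_ineq4 order.trans)
  then show ?thesis by blast
qed

lemma asymptotic_radius_nonneg: "0 \<le> asymptotic_radius F x z"
  unfolding asymptotic_radius_def
  using bound_set_nonempty eventually_bound_nonneg by (intro cInf_greatest) auto

lemma eventually_le_of_asymptotic_radius_less:
  "\<forall>\<^sub>F t in F. norm (x t - z) \<le> c" if "asymptotic_radius F x z < c"
proof -
  obtain d where "\<forall>\<^sub>F t in F. norm (x t - z) \<le> d" "d < c"
    using cInf_lessD[OF bound_set_nonempty] \<open>asymptotic_radius F x z < c\<close> unfolding asymptotic_radius_def by blast
  then show ?thesis
    by (auto elim: eventually_mono)
qed

lemma asymptotic_radius_sq_le: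
  assumes ev: "\<forall>\<^sub>F t in F. (norm (x t - z))\<^sup>2 \<le> c"
  shows "(asymptotic_radius F x z)\<^sup>2 \<le> c"
proof -
  obtain t where "(norm (x t - z))\<^sup>2 \<le> c"
    using eventually_happens[OF ev] nontriv by blast
  then have "0 \<le> c" by (rule order.trans[OF zero_le_power2])
  have "\<forall>\<^sub>F t in F. norm (x t - z) \<le> sqrt c"
    using ev by eventually_elim (rule real_le_rsqrt)
  then have "asymptotic_radius F x z \<le> sqrt c"
    by (rule asymptotic_radius_le)
  then show ?thesis
    using \<open>0 \<le> c\<close> asymptotic_radius_nonneg by (metis power_mono real_sqrt_pow2)
qed

text \<open>With \<open>e = norm (w - z)\<close> this makes the radius Lipschitz in its centre; with
  arbitrarily small \<open>e\<close> it compares the radii at \<open>z\<close> and at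
  \<open>T z\<close>.\<close>

lemma asymptotic_radius_le_add:
  assumes "\<forall>\<^sub>F t in F. norm (x t - w) \<le> norm (x t - z) + e"
  shows "asymptotic_radius F x w \<le> asymptotic_radius F x z + e"
proof (rule field_le_epsilon)
  fix d :: real
  assume "0 < d"
  then have "\<forall>\<^sub>F t in F. norm (x t - z) \<le> asymptotic_radius F x z + d"
    by (intro eventually_le_of_asymptotic_radius_less) simp
  with assms have "\<forall>\<^sub>F t in F. norm (x t - w) \<le> asymptotic_radius F x z + e + d"
    by eventually_elim linarith
  then show "asymptotic_radius F x w \<le> asymptotic_radius F x z + e + d"
    by (rule asymptotic_radius_le)
qed

text \<open>A limit is inherited by every nontrivial subfilter, so this is what makes radii at fixed
  points independent of the subfilter.\<close>

lemma asymptotic_radius_eq_lim: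
  assumes "((\<lambda>t. norm (x t - z)) \<longlongrightarrow> r) F"
  shows "asymptotic_radius F x z = r"
proof (rule antisym)
  show "asymptotic_radius F x z \<le> r"
  proof (rule field_le_epsilon)
    fix d :: real
    assume "0 < d"
    then have "\<forall>\<^sub>F t in F. norm (x t - z) < r + d"
      using assms by (intro order_tendstoD) auto
    then show "asymptotic_radius F x z \<le> r + d"
      by (intro asymptotic_radius_le) (auto elim: eventually_mono)
  qed
  show "r \<le> asymptotic_radius F x z"
    by (rule dense_ge, rule tendsto_upperbound[OF assms _ nontriv])
      (rule eventually_le_of_asymptotic_radius_less)
qed

end

text \<open>The parallelogram identity for \<open>x t - z\<close> and \<open>x t - w\<close> passes
  to the squared radii, which are therefore subject to the midpoint minimization.\<close>

lemma asymptotic_center_exists: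
  fixes x :: "'b \<Rightarrow> 'a::{real_inner, complete_space}"
  assumes F: "F \<noteq> bot" and B: "\<forall>\<^sub>F t in F. norm (x t) \<le> B"
  obtains z where "\<And>w. (asymptotic_radius F x z)\<^sup>2 + (norm (z - w))\<^sup>2 / 2 \<le> (asymptotic_radius F x w)\<^sup>2"
proof (rule midpoint_convex_minimizer[of "\<lambda>z. (asymptotic_radius F x z)\<^sup>2" 0])
  let ?a = "asymptotic_radius F x"
  have "\<bar>?a w - ?a z\<bar> \<le> norm (w - z)" for z w
  proof -
    have "?a w \<le> ?a z + norm (w - z)" for w z
      using norm_triangle_ineq[of "x t - z" "z - w" for t]
      by (intro asymptotic_radius_le_add[OF F B] always_eventually)
        (simp add: norm_minus_commute)
    from this[of w z] this[of z w] show ?thesis by (simp add: norm_minus_commute)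
  qed
  then have "1-lipschitz_on UNIV ?a"
    by (intro lipschitz_onI) (auto simp: dist_real_def dist_norm)
  then show "continuous_on UNIV (\<lambda>z. (?a z)\<^sup>2)"
    by (intro continuous_intros lipschitz_on_continuous_on)
  show "(?a ((1/2) *\<^sub>R (z + w)))\<^sup>2 \<le> ((?a z)\<^sup>2 + (?a w)\<^sup>2) / 2 - (norm (z - w))\<^sup>2 / 4" for z w
  proof -
    let ?m = "(1/2) *\<^sub>R (z + w)"
    \<comment> \<open>The radius itself need not be an eventual bound, so a slack \<open>e\<close>
      is carried along and sent to 0 afterwards.\<close>
    have *: "(?a ?m)\<^sup>2 \<le> ((?a z + e)\<^sup>2 + (?a w + e)\<^sup>2) / 2 - (norm (z - w))\<^sup>2 / 4"
      if "0 < e" for e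
    proof -
      let ?R = "((?a z + e)\<^sup>2 + (?a w + e)\<^sup>2) / 2 - (norm (z - w))\<^sup>2 / 4"
      have "\<forall>\<^sub>F t in F. norm (x t - z) \<le> ?a z + e" "\<forall>\<^sub>F t in F. norm (x t - w) \<le> ?a w + e"
        using that by (auto intro!: eventually_le_of_asymptotic_radius_less[OF F B])
      then have "\<forall>\<^sub>F t in F. (norm (x t - ?m))\<^sup>2 \<le> ?R"
      proof eventually_elim
        case (elim t)
        have eq: "x t - ?m = (1/2) *\<^sub>R ((x t - z) + (x t - w))"
          by (simp add: scaleR_diff_right scaleR_add_right algebra_simps flip: scaleR_add_left)
        have "(norm (x t - z))\<^sup>2 \<le> (?a z + e)\<^sup>2" "(norm (x t - w))\<^sup>2 \<le> (?a w + e)\<^sup>2"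
          using elim by (auto intro: power_mono)
        then show ?case
          unfolding eq norm_midpoint_sq by (simp add: norm_minus_commute)
      qed
      then show ?thesis
        by (rule asymptotic_radius_sq_le[OF F B])
    qed
    have "((\<lambda>e. ((?a z + e)\<^sup>2 + (?a w + e)\<^sup>2) / 2 - (norm (z - w))\<^sup>2 / 4) \<longlongrightarrow>
        ((?a z + 0)\<^sup>2 + (?a w + 0)\<^sup>2) / 2 - (norm (z - w))\<^sup>2 / 4) (at_right 0)"
      by (intro tendsto_intros) auto
    then have "(?a ?m)\<^sup>2 \<le> ((?a z + 0)\<^sup>2 + (?a w + 0)\<^sup>2) / 2 - (norm (z - w))\<^sup>2 / 4"
      by (rule tendsto_lowerbound) (auto simp: eventually_at_filter intro!: always_eventually *)
    then show ?thesis by simp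
  qed
  show "0 \<le> (asymptotic_radius F x z)\<^sup>2" for z by simp
qed (rule that)


text \<open>As \<open>T (x t)\<close> and \<open>x t\<close> merge, \<open>T z\<close> has no larger
  radius than the centre \<open>z\<close>; the quadratic gap then forces
  \<open>T z = z\<close>.\<close>

lemma fixed_asymptotic_center:
  fixes x :: "'b \<Rightarrow> 'a::{real_inner, complete_space}"
  assumes T: "nonexpansive T" and res: "((\<lambda>t. T (x t) - x t) \<longlongrightarrow> 0) F"
    and F: "F \<noteq> bot" and B: "\<forall>\<^sub>F t in F. norm (x t) \<le> B"
  obtains z where "z \<in> Fix T"
    "\<And>w. (asymptotic_radius F x z)\<^sup>2 + (norm (z - w))\<^sup>2 / 2 \<le> (asymptotic_radius F x w)\<^sup>2"
proof -
  let ?a = "asymptotic_radius F x"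
  obtain z where z: "\<And>w. (?a z)\<^sup>2 + (norm (z - w))\<^sup>2 / 2 \<le> (?a w)\<^sup>2"
    using asymptotic_center_exists[OF F B] by blast
  have "?a (T z) \<le> ?a z"
  proof (rule field_le_epsilon)
    fix e :: real
    assume "0 < e"
    then have "\<forall>\<^sub>F t in F. norm (T (x t) - x t) < e"
      using res by (auto simp: tendsto_iff dist_norm)
    then have "\<forall>\<^sub>F t in F. norm (x t - T z) \<le> norm (x t - z) + e"
    proof eventually_elim
      case (elim t)
      have "norm (x t - T z) \<le> norm (T (x t) - T z) + norm (T (x t) - x t)"
        using norm_triangle_ineq4[of "T (x t) - T z" "T (x t) - x t"] by simp
      also have "\<dots> \<le> norm (x t - z) + e"
        using T elim by (intro add_mono) (auto simp: nonexpansive_def)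
      finally show ?case .
    qed
    then show "?a (T z) \<le> ?a z + e"
      by (rule asymptotic_radius_le_add[OF F B])
  qed
  then have "(?a (T z))\<^sup>2 \<le> (?a z)\<^sup>2"
    by (rule power_mono) (rule asymptotic_radius_nonneg[OF F B])
  with z[of "T z"] have "norm (z - T z) = 0"
    by (smt (verit) half_gt_zero zero_less_power2)
  then have "z \<in> Fix T" by (simp add: Fix_def)
  then show thesis using z by (rule that)
qed

text \<open>The limit is the centre \<open>p\<close> along \<open>F\<close>. If
  \<open>v \<bullet> (x t - p)\<close> kept exceeding some \<open>e > 0\<close>, \<open>p\<close>
  would still be the centre along the times where it does, yet moving \<open>p\<close> slightly
  towards \<open>v\<close> would lower the radius there.\<close>

lemma opial_weak_convergence:
  fixes x :: "'b \<Rightarrow> 'a::{real_inner, complete_space}"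
  assumes T: "nonexpansive T" and res: "((\<lambda>t. T (x t) - x t) \<longlongrightarrow> 0) F"
    and F: "F \<noteq> bot" and "Fix T \<noteq> {}"
    and lim: "\<And>y. y \<in> Fix T \<Longrightarrow> \<exists>r. ((\<lambda>t. norm (x t - y)) \<longlongrightarrow> r) F"
  shows "\<exists>p\<in>Fix T. weakly_tendsto x p F"
proof -
  obtain y r where y: "y \<in> Fix T" "((\<lambda>t. norm (x t - y)) \<longlongrightarrow> r) F"
    using \<open>Fix T \<noteq> {}\<close> lim by blast
  then have "\<forall>\<^sub>F t in F. norm (x t - y) < r + 1"
    by (intro order_tendstoD) auto
  then have "\<forall>\<^sub>F t in F. norm (x t) \<le> r + 1 + norm y"
  proof eventually_elim
    case (elim t)
    then show ?case using norm_triangle_sub[of "x t" y] by linarith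
  qed
  then obtain b where B: "\<forall>\<^sub>F t in F. norm (x t) \<le> b" by blast
  obtain p where p: "p \<in> Fix T"
    "\<And>w. (asymptotic_radius F x p)\<^sup>2 + (norm (p - w))\<^sup>2 / 2 \<le> (asymptotic_radius F x w)\<^sup>2"
    using fixed_asymptotic_center[OF T res F B] by blast
  obtain r where r: "((\<lambda>t. norm (x t - p)) \<longlongrightarrow> r) F"
    using lim[OF p(1)] by blast
  have less: "\<forall>\<^sub>F t in F. v \<bullet> (x t - p) < e" if "0 < e" for v e
  proof (rule ccontr)
    assume not: "\<not> ?thesis"
    \<comment> \<open>The restriction of \<open>F\<close> to the offending times; it is nontrivial
      precisely because the claim fails.\<close>
    define F' where "F' = inf F (principal {t. e \<le> v \<bullet> (x t - p)})"
    have "F' \<le> F" by (simp add: F'_def)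
    have F': "F' \<noteq> bot"
      using not by (simp add: F'_def trivial_limit_def eventually_inf_principal not_le)
    have B': "\<forall>\<^sub>F t in F'. norm (x t) \<le> b"
      using B \<open>F' \<le> F\<close> by (auto simp: le_filter_def)
    let ?a = "asymptotic_radius F' x"
    have radius_eq: "?a q = asymptotic_radius F x q" if q: "q \<in> Fix T" for q
    proof -
      obtain s where s: "((\<lambda>t. norm (x t - q)) \<longlongrightarrow> s) F"
        using lim[OF q] by blast
      show ?thesis
        using asymptotic_radius_eq_lim[OF F B s]
          asymptotic_radius_eq_lim[OF F' B' tendsto_mono[OF \<open>F' \<le> F\<close> s]] by simp
    qed
    obtain p' where p': "p' \<in> Fix T" "\<And>w. (?a p')\<^sup>2 + (norm (p' - w))\<^sup>2 / 2 \<le> (?a w)\<^sup>2"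
      using fixed_asymptotic_center[OF T tendsto_mono[OF \<open>F' \<le> F\<close> res] F' B'] by blast
    \<comment> \<open>Each of \<open>p\<close> and \<open>p'\<close> has the smaller squared radius
      by half their squared distance; adding the two inequalities leaves no room for a
      distance.\<close>
    have "norm (p - p') = 0"
      using p(2)[of p'] p'(2)[of p] radius_eq[OF p(1)] radius_eq[OF p'(1)]
      by (smt (verit) half_gt_zero zero_less_power2 norm_minus_commute)
    then have "p' = p" by simp
    have r': "((\<lambda>t. (norm (x t - p))\<^sup>2) \<longlongrightarrow> r\<^sup>2) F'"
      using tendsto_mono[OF \<open>F' \<le> F\<close> r] by (rule tendsto_power)
    define n where "n = (norm v)\<^sup>2 + 1"
    have n: "0 < n" by (simp add: n_def add_nonneg_pos)
    \<comment> \<open>The step balances gain and cost: the inner product lowers the squared distance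
      by at least \<open>2 * s * e\<close>, the quadratic term costs at most \<open>s * e\<close>,
      and the tolerance \<open>s * e / 2\<close> leaves a net drop of
      \<open>s * e / 2\<close>.\<close>
    define s where "s = e / n"
    have s: "0 < s" "s * n = e"
      using n \<open>0 < e\<close> by (auto simp: s_def)
    have "\<forall>\<^sub>F t in F'. (norm (x t - p))\<^sup>2 < r\<^sup>2 + s * e / 2"
      using r' by (rule order_tendstoD) (simp add: s \<open>0 < e\<close>)
    moreover have "\<forall>\<^sub>F t in F'. e \<le> v \<bullet> (x t - p)"
      by (simp add: F'_def eventually_inf_principal)
    ultimately have "\<forall>\<^sub>F t in F'. (norm (x t - (p + s *\<^sub>R v)))\<^sup>2 \<le> r\<^sup>2 - s * e / 2"
    proof eventually_elim
      case (elim t)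
      have "(norm (x t - (p + s *\<^sub>R v)))\<^sup>2
          = (norm (x t - p))\<^sup>2 - 2 * s * (v \<bullet> (x t - p)) + s * (s * (norm v)\<^sup>2)"
        unfolding power2_norm_eq_inner
        by (simp add: inner_diff_left inner_diff_right inner_add_left inner_add_right
            inner_commute algebra_simps)
      also have "\<dots> \<le> (r\<^sup>2 + s * e / 2) - 2 * s * e + s * e"
      proof (intro add_mono diff_mono)
        show "2 * s * e \<le> 2 * s * (v \<bullet> (x t - p))"
          using elim s by simp
        show "s * (s * (norm v)\<^sup>2) \<le> s * e"
          using s(1) by (intro mult_left_mono) (auto simp: n_def simp flip: s(2))
      qed (use elim in simp)
      finally show ?case by (simp add: algebra_simps)
    qed
    then have "(?a (p + s *\<^sub>R v))\<^sup>2 \<le> r\<^sup>2 - s * e / 2"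
      by (rule asymptotic_radius_sq_le[OF F' B'])
    moreover have "(?a p)\<^sup>2 = r\<^sup>2"
      by (simp add: asymptotic_radius_eq_lim[OF F' B' tendsto_mono[OF \<open>F' \<le> F\<close> r]])
    moreover have "0 < s * e" using s \<open>0 < e\<close> by simp
    moreover have "0 \<le> (norm (p - (p + s *\<^sub>R v)))\<^sup>2" by simp
    ultimately show False
      using p'(2)[of "p + s *\<^sub>R v"] unfolding \<open>p' = p\<close> by linarith
  qed
  have "weakly_tendsto x p F"
    unfolding weakly_tendsto_def
  proof (intro allI impI)
    fix \<phi> :: "'a \<Rightarrow> real"
    assume "bounded_linear \<phi>"
    then obtain v where v: "\<And>w. \<phi> w = v \<bullet> w"
      using riesz_representation by blast
    show "((\<lambda>t. \<phi> (x t)) \<longlongrightarrow> \<phi> p) F"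
    proof (rule tendstoI)
      fix e :: real
      assume "0 < e"
      from less[OF this, of v] less[OF this, of "- v"]
      show "\<forall>\<^sub>F t in F. dist (\<phi> (x t)) (\<phi> p) < e"
        by eventually_elim (simp add: v dist_real_def inner_diff_right abs_less_iff)
    qed
  qed
  with p(1) show ?thesis by blast
qed

subsection \<open>Trajectories\<close>

text \<open>The exceptional times are collected in one set \<open>N\<close>, so that all
  differential inequalities below are tested at the same times.\<close>

locale trajectory =
  fixes T :: "'a::real_inner \<Rightarrow> 'a" and l :: "real \<Rightarrow> real" and x :: "real \<Rightarrow> 'a" and N :: "real set"
  assumes T: "nonexpansive T"
    and l: "\<And>t. 0 \<le> t \<Longrightarrow> 0 \<le> l t \<and> l t \<le> 1"
    and l_measurable: "l \<in> borel_measurable (lebesgue_on {0..})"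
    and ac: "\<And>b. 0 < b \<Longrightarrow> absolutely_continuous_on_Icc 0 b x"
    and N: "negligible N"
    and ode: "\<And>t. 0 \<le> t \<Longrightarrow> t \<notin> N \<Longrightarrow>
      (x has_vector_derivative l t *\<^sub>R (T (x t) - x t)) (at t within {0..})"
begin

abbreviation residual :: "real \<Rightarrow> real" where
  "residual t \<equiv> norm (T (x t) - x t)"

lemma nonexp: "norm (T u - T v) \<le> norm (u - v)"
  using T by (simp add: nonexpansive_def)

lemma continuous_x: "continuous_on {0..} x"
proof -
  have "continuous (at t within {0..}) x" if "0 \<le> t" for t
  proof -
    obtain G where "G integrable_on {0..t+1}"
      "\<And>s r. 0 \<le> s \<Longrightarrow> s \<le> r \<Longrightarrow> r \<le> t+1 \<Longrightarrow> norm (x r - x s) \<le> integral {s..r} G"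
      using absolutely_continuous_on_Icc_increment[OF ac[of "t+1"]] \<open>0 \<le> t\<close> by (metis add_nonneg_pos zero_less_one)
    then have "continuous_on {0..t+1} x"
      by (rule continuous_on_increment_bound)
    then have "continuous (at t within {0..t+1}) x"
      using \<open>0 \<le> t\<close> by (simp add: continuous_on_eq_continuous_within)
    \<comment> \<open>The extra length 1 keeps the right endpoint away from \<open>t\<close>, so
      both sets agree near \<open>t\<close>.\<close>
    moreover have "at t within {0..t+1} = at t within {0..}"
      by (rule at_within_nhd[of t "{..<t+1}"]) auto
    ultimately show ?thesis by simp
  qed
  then show ?thesis by (simp add: continuous_on_eq_continuous_within)
qed

lemma continuous_residual: "continuous_on {0..} residual"
proof -
  have "1-lipschitz_on UNIV T"
    by (rule lipschitz_onI) (auto simp: dist_norm nonexp)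
  then have "continuous_on UNIV T" by (rule lipschitz_on_continuous_on)
  then have "continuous_on {0..} (\<lambda>t. T (x t))"
    by (rule continuous_on_compose2[OF _ continuous_x]) simp
  then show ?thesis
    by (intro continuous_intros continuous_x)
qed

text \<open>A quantity that is Lipschitz in \<open>x\<close> inherits the increment bound
  \<open>L * G\<close>, so it obeys differential inequalities without being shown to be an
  indefinite integral.\<close>

lemma lipschitz_increment_le:
  fixes F f :: "real \<Rightarrow> real"
  assumes "0 \<le> a" "a \<le> b" and f: "f integrable_on {a..b}" and "0 \<le> L"
    and lip: "\<And>s t. a \<le> s \<Longrightarrow> s \<le> t \<Longrightarrow> t \<le> b \<Longrightarrow> F t - F s \<le> L * norm (x t - x s)"
    and der: "\<And>t e. a \<le> t \<Longrightarrow> t \<le> b \<Longrightarrow> t \<notin> N \<Longrightarrow> 0 < e \<Longrightarrow>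
      \<exists>d>0. \<forall>r s. a \<le> r \<and> r \<le> t \<and> t \<le> s \<and> s \<le> b \<and> t - r < d \<and> s - t < d \<longrightarrow>
        F s - F r \<le> (f t + e) * (s - r)"
  shows "F b - F a \<le> integral {a..b} f"
proof -
  have "0 < b + 1" using assms(1,2) by simp
  then obtain G where G: "G integrable_on {0..b+1}"
    and inc: "\<And>s t. 0 \<le> s \<Longrightarrow> s \<le> t \<Longrightarrow> t \<le> b+1 \<Longrightarrow> norm (x t - x s) \<le> integral {s..t} G"
    using absolutely_continuous_on_Icc_increment[OF ac] by metis
  show ?thesis
  proof (rule increment_le_integral[OF \<open>a \<le> b\<close> N _ f])
    show "(\<lambda>t. L * G t) integrable_on {a..b}"
      using integrable_on_subinterval[OF G, of a b] assms(1,2) by (intro integrable_on_mult_right) auto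
    show "F t - F s \<le> integral {s..t} (\<lambda>t. L * G t)" if "a \<le> s" "s \<le> t" "t \<le> b" for s t
    proof -
      have "L * norm (x t - x s) \<le> L * integral {s..t} G"
        using inc[of s t] that assms(1) \<open>0 \<le> L\<close> by (intro mult_left_mono) auto
      with lip[OF that] show ?thesis by simp
    qed
  qed (use der in auto)
qed

text \<open>A mean value inequality: outside \<open>N\<close> the speed is
  \<open>l t * residual t\<close>, hence at most \<open>c\<close>. It is applied to the real
  function \<open>norm (x t - x a)\<close>, which starts at 0.\<close>

lemma increment_norm_le:
  assumes "0 \<le> a" "a \<le> b" and c: "\<And>t. a \<le> t \<Longrightarrow> t \<le> b \<Longrightarrow> residual t \<le> c"
  shows "norm (x b - x a) \<le> c * (b - a)"
proof -
  have "norm (x b - x a) - norm (x a - x a) \<le> integral {a..b} (\<lambda>_. c)"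
  proof (rule lipschitz_increment_le[OF assms(1,2), where L = 1 and F = "\<lambda>t. norm (x t - x a)"])
    show "norm (x t - x a) - norm (x s - x a) \<le> 1 * norm (x t - x s)" for s t
      using norm_triangle_ineq2[of "x t - x a" "x s - x a"] by simp
    fix t e :: real
    assume t: "a \<le> t" "t \<le> b" "t \<notin> N" and "0 < e"
    let ?D = "l t *\<^sub>R (T (x t) - x t)"
    have t0: "0 \<le> t" using t assms(1) by simp
    have "norm ?D \<le> 1 * residual t"
      using l[OF t0] by (simp add: mult_left_le_one_le)
    then have D: "norm ?D \<le> c" using c[OF t(1,2)] by simp
    obtain d where d: "0 < d" "\<And>r s. r \<in> {0..} \<Longrightarrow> s \<in> {0..} \<Longrightarrow> r \<le> t \<Longrightarrow> t \<le> s \<Longrightarrow>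
        t - r < d \<Longrightarrow> s - t < d \<Longrightarrow> norm (x s - x r - (s - r) *\<^sub>R ?D) \<le> e * (s - r)"
      using vector_derivative_straddle[OF ode[OF t0 t(3)] _ \<open>0 < e\<close>] t0 by auto
    have "norm (x s - x a) - norm (x r - x a) \<le> (c + e) * (s - r)"
      if "a \<le> r \<and> r \<le> t \<and> t \<le> s \<and> s \<le> b \<and> t - r < d \<and> s - t < d" for r s
    proof -
      have "norm (x s - x a) - norm (x r - x a) \<le> norm (x s - x r)"
        using norm_triangle_ineq2[of "x s - x a" "x r - x a"] by simp
      also have "\<dots> \<le> norm (x s - x r - (s - r) *\<^sub>R ?D) + norm ((s - r) *\<^sub>R ?D)"
        by (metis diff_add_cancel norm_triangle_ineq)
      also have "norm ((s - r) *\<^sub>R ?D) = (s - r) * norm ?D"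
        using that by (subst norm_scaleR) (simp only: abs_of_nonneg diff_ge_0_iff_ge order.trans[of r t s])
      also have "norm (x s - x r - (s - r) *\<^sub>R ?D) + (s - r) * norm ?D \<le> e * (s - r) + (s - r) * c"
        using that D d(2)[of r s] assms(1) by (intro add_mono mult_left_mono) auto
      finally show ?thesis by (simp add: algebra_simps)
    qed
    with d(1) show "\<exists>d>0. \<forall>r s. a \<le> r \<and> r \<le> t \<and> t \<le> s \<and> s \<le> b \<and> t - r < d \<and> s - t < d \<longrightarrow>
        norm (x s - x a) - norm (x r - x a) \<le> (c + e) * (s - r)" by blast
  qed auto
  then show ?thesis
    using assms(2) by (simp add: mult.commute)
qed

text \<open>
  The function \<open>t \<mapsto> T (x t)\<close> need not be known to be differentiable: comparing \<open>T (x s)\<close> with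
  \<open>T (x r)\<close> by nonexpansiveness already bounds the difference quotients of the residual.
\<close>
lemma residual_antitone:
  assumes "0 \<le> a" "a \<le> b"
  shows "residual b \<le> residual a"
proof -
  have "residual b - residual a \<le> integral {a..b} (\<lambda>_. 0)"
  proof (rule lipschitz_increment_le[OF assms, where L = 2])
    show "residual t - residual s \<le> 2 * norm (x t - x s)" for s t
    proof -
      have "residual t - residual s \<le> norm ((T (x t) - T (x s)) - (x t - x s))"
        using norm_triangle_ineq2[of "T (x t) - x t" "T (x s) - x s"] by (simp add: algebra_simps)
      also have "\<dots> \<le> norm (T (x t) - T (x s)) + norm (x t - x s)"
        by (rule norm_triangle_ineq4)
      finally show ?thesis using nonexp[of "x t" "x s"] by simp
    qed
    fix t e :: real
    assume t: "a \<le> t" "t \<le> b" "t \<notin> N" and "0 < e"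
    \<comment> \<open>Estimates \<open>1\<close> and \<open>2\<close> below each incur an error of
      \<open>2 * \<epsilon> * (s - r)\<close>.\<close>
    define \<epsilon> where "\<epsilon> = e / 4"
    have \<epsilon>: "0 < \<epsilon>" "e = 4 * \<epsilon>" using \<open>0 < e\<close> by (auto simp: \<epsilon>_def)
    have t0: "0 \<le> t" using t assms(1) by simp
    let ?u = "\<lambda>t. T (x t) - x t"
    obtain d1 where d1: "0 < d1" "\<And>r s. r \<in> {0..} \<Longrightarrow> s \<in> {0..} \<Longrightarrow> r \<le> t \<Longrightarrow> t \<le> s \<Longrightarrow>
        t - r < d1 \<Longrightarrow> s - t < d1 \<Longrightarrow> norm (x s - x r - (s - r) *\<^sub>R l t *\<^sub>R ?u t) \<le> \<epsilon> * (s - r)"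
      using vector_derivative_straddle[OF ode[OF t0 t(3)] _ \<epsilon>(1)] t0 by auto
    obtain d2 where d2: "0 < d2" "\<And>r. 0 \<le> r \<Longrightarrow> dist r t < d2 \<Longrightarrow> dist (x r) (x t) < \<epsilon> / 2"
      using continuous_x t0 \<epsilon>(1) unfolding continuous_on_iff by (metis atLeast_iff half_gt_zero)
    \<comment> \<open>The bound 1/2 on each side keeps \<open>s - r\<close> at most 1, which makes
      \<open>k \<le> 1\<close> below.\<close>
    define d where "d = min (1/2) (min d1 d2)"
    have "residual s - residual r \<le> (0 + e) * (s - r)"
      if rs: "a \<le> r \<and> r \<le> t \<and> t \<le> s \<and> s \<le> b \<and> t - r < d \<and> s - t < d" for r s
    proof -
      \<comment> \<open>Up to small errors, \<open>x s\<close> is the relaxed step from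
        \<open>x r\<close> towards \<open>T (x r)\<close> with parameter \<open>k\<close>. Then
        \<open>T (x s) - T (x r)\<close> costs \<open>k * residual r\<close> and
        \<open>T (x r) - x s\<close> costs \<open>(1 - k) * residual r\<close>, together
        \<open>residual r\<close>.\<close>
      define k where "k = (s - r) * l t"
      have "(s - r) * l t \<le> 1 * 1"
        using rs l[OF t0] by (intro mult_mono) (auto simp: d_def)
      then have k: "0 \<le> k" "k \<le> 1" "k \<le> s - r"
        using rs l[OF t0] by (auto simp: k_def mult_left_le)
      have E: "norm (x s - x r - k *\<^sub>R ?u t) \<le> \<epsilon> * (s - r)"
        using d1(2)[of r s] rs assms(1) by (simp add: d_def k_def)
      have "dist (x r) (x t) < \<epsilon> / 2"
        using rs assms(1) by (intro d2(2)) (auto simp: d_def dist_real_def)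
      have "norm (?u r - ?u t) \<le> norm (T (x r) - T (x t)) + norm (x r - x t)"
        using norm_triangle_ineq4[of "T (x r) - T (x t)" "x r - x t"] by (simp add: algebra_simps)
      then have near: "norm (?u r - ?u t) \<le> \<epsilon>"
        using nonexp[of "x r" "x t"] \<open>dist (x r) (x t) < \<epsilon> / 2\<close> by (simp add: dist_norm)
      have kn: "k * norm (?u r - ?u t) \<le> (s - r) * \<epsilon>"
        using k near by (intro mult_mono) auto
      have "k *\<^sub>R ?u t = k *\<^sub>R ?u r - k *\<^sub>R (?u r - ?u t)"
        by (simp add: algebra_simps)
      then have ku: "norm (k *\<^sub>R ?u t) \<le> k * residual r + (s - r) * \<epsilon>"
        using norm_triangle_ineq4[of "k *\<^sub>R ?u r" "k *\<^sub>R (?u r - ?u t)"] k kn by simp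
      have "norm (x s - x r) \<le> norm (x s - x r - k *\<^sub>R ?u t) + norm (k *\<^sub>R ?u t)"
        by (metis diff_add_cancel norm_triangle_ineq)
      then have 1: "norm (T (x s) - T (x r)) \<le> \<epsilon> * (s - r) + (k * residual r + (s - r) * \<epsilon>)"
        using nonexp[of "x s" "x r"] E ku by linarith
      have "T (x r) - x s = ((1 - k) *\<^sub>R ?u r + k *\<^sub>R (?u r - ?u t)) - (x s - x r - k *\<^sub>R ?u t)"
        by (simp add: algebra_simps)
      also have "norm \<dots> \<le> norm ((1 - k) *\<^sub>R ?u r + k *\<^sub>R (?u r - ?u t)) + norm (x s - x r - k *\<^sub>R ?u t)"
        by (rule norm_triangle_ineq4)
      also have "norm ((1 - k) *\<^sub>R ?u r + k *\<^sub>R (?u r - ?u t))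
          \<le> (1 - k) * residual r + k * norm (?u r - ?u t)"
        using norm_triangle_ineq[of "(1 - k) *\<^sub>R ?u r" "k *\<^sub>R (?u r - ?u t)"] k by simp
      finally have 2: "norm (T (x r) - x s) \<le> (1 - k) * residual r + (s - r) * \<epsilon> + \<epsilon> * (s - r)"
        using kn E by linarith
      have "residual s \<le> norm (T (x s) - T (x r)) + norm (T (x r) - x s)"
        using norm_triangle_ineq[of "T (x s) - T (x r)" "T (x r) - x s"] by simp
      also have "\<dots> \<le> residual r + e * (s - r)"
        using 1 2 by (simp add: \<epsilon>(2) algebra_simps)
      finally show ?thesis by simp
    qed
    moreover have "0 < d" using d1(1) d2(1) by (simp add: d_def)
    ultimately show "\<exists>d>0. \<forall>r s. a \<le> r \<and> r \<le> t \<and> t \<le> s \<and> s \<le> b \<and> t - r < d \<and> s - t < d \<longrightarrow>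
        residual s - residual r \<le> (0 + e) * (s - r)" by blast
  qed auto
  then show ?thesis by simp
qed

section \<open>Dissipation, distance to fixed points, and decay of the residual\<close>

lemma dissipation_measurable: "(\<lambda>t. l t * (residual t)\<^sup>2) \<in> borel_measurable (lebesgue_on {0..})"
proof -
  have "residual \<in> borel_measurable (lebesgue_on {0..})"
    by (rule continuous_imp_measurable_on_sets_lebesgue[OF continuous_residual]) simp
  with l_measurable show ?thesis by measurable
qed

lemma dissipation_bounds:
  assumes "0 \<le> t"
  shows "0 \<le> l t * (residual t)\<^sup>2" "l t * (residual t)\<^sup>2 \<le> (residual 0)\<^sup>2"
proof -
  have "l t * (residual t)\<^sup>2 \<le> 1 * (residual 0)\<^sup>2"
    using l[OF assms] residual_antitone[OF _ assms] by (intro mult_mono power_mono) auto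
  then show "l t * (residual t)\<^sup>2 \<le> (residual 0)\<^sup>2" by simp
  show "0 \<le> l t * (residual t)\<^sup>2" using l[OF assms] by simp
qed

lemma dissipation_integrable_Icc:
  assumes "0 \<le> a"
  shows "(\<lambda>t. l t * (residual t)\<^sup>2) integrable_on {a..b}"
proof (rule measurable_bounded_by_integrable_imp_integrable)
  show "(\<lambda>t. l t * (residual t)\<^sup>2) \<in> borel_measurable (lebesgue_on {a..b})"
    by (rule measurable_restrict_mono[OF dissipation_measurable]) (use assms in auto)
  show "(\<lambda>_. (residual 0)\<^sup>2) integrable_on {a..b}" by (rule integrable_const_ivl)
  show "norm (l t * (residual t)\<^sup>2) \<le> (residual 0)\<^sup>2" if "t \<in> {a..b}" for t
    using dissipation_bounds[of t] that assms by simp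
qed auto

text \<open>An energy inequality with two uses: distances to fixed points are nonincreasing, and the
  total dissipation is at most the initial squared distance.\<close>

lemma sq_dist_fixed_point_decrease:
  assumes "0 \<le> a" "a \<le> b" and y: "y \<in> Fix T"
  shows "(norm (x b - y))\<^sup>2 + integral {a..b} (\<lambda>t. l t * (residual t)\<^sup>2) \<le> (norm (x a - y))\<^sup>2"
proof -
  \<comment> \<open>Squaring is Lipschitz only on bounded sets; compactness of \<open>{a..b}\<close>
    provides \<open>C\<close> and with it the constant \<open>2 * C\<close>.\<close>
  have "continuous_on {a..b} (\<lambda>t. norm (x t - y))"
    using assms(1) by (intro continuous_intros continuous_on_subset[OF continuous_x]) auto
  then have "bounded ((\<lambda>t. norm (x t - y)) ` {a..b})"
    by (intro compact_imp_bounded compact_continuous_image) auto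
  then obtain C where "\<forall>t\<in>{a..b}. norm (x t - y) \<le> C"
    by (auto simp: bounded_iff)
  then have C: "norm (x t - y) \<le> C" if "a \<le> t" "t \<le> b" for t
    using that by auto
  have "(norm (x b - y))\<^sup>2 - (norm (x a - y))\<^sup>2 \<le> integral {a..b} (\<lambda>t. - (l t * (residual t)\<^sup>2))"
  proof (rule lipschitz_increment_le[OF assms(1,2), where L = "2 * C"])
    show "(\<lambda>t. - (l t * (residual t)\<^sup>2)) integrable_on {a..b}"
      by (intro integrable_neg dissipation_integrable_Icc assms)
    show "0 \<le> 2 * C" using C[of a] assms(2) norm_ge_zero[of "x a - y"] by linarith
    show "(norm (x t - y))\<^sup>2 - (norm (x s - y))\<^sup>2 \<le> 2 * C * norm (x t - x s)"
      if "a \<le> s" "s \<le> t" "t \<le> b" for s t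
    proof -
      have "(norm (x t - y))\<^sup>2 - (norm (x s - y))\<^sup>2
          = (norm (x t - y) + norm (x s - y)) * (norm (x t - y) - norm (x s - y))"
        by (simp add: power2_eq_square algebra_simps)
      also have "\<dots> \<le> (norm (x t - y) + norm (x s - y)) * norm (x t - x s)"
        using norm_triangle_ineq2[of "x t - y" "x s - y"] by (intro mult_left_mono) auto
      also have "\<dots> \<le> (2 * C) * norm (x t - x s)"
        using C[of t] C[of s] that by (intro mult_right_mono) auto
      finally show ?thesis .
    qed
    fix t e :: real
    assume t: "a \<le> t" "t \<le> b" "t \<notin> N" and "0 < e"
    have t0: "0 \<le> t" using t assms(1) by simp
    let ?D = "2 * ((x t - y) \<bullet> (l t *\<^sub>R (T (x t) - x t)))"
    have der: "((\<lambda>t. (norm (x t - y))\<^sup>2) has_vector_derivative ?D) (at t within {0..})"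
      unfolding power2_norm_eq_inner has_vector_derivative_def
      by (rule has_derivative_eq_rhs)
        (use ode[OF t0 t(3)] in \<open>auto intro!: derivative_eq_intros
          simp: has_vector_derivative_def inner_commute fun_eq_iff algebra_simps\<close>)
    obtain d where d: "0 < d" "\<And>r s. r \<in> {0..} \<Longrightarrow> s \<in> {0..} \<Longrightarrow> r \<le> t \<Longrightarrow> t \<le> s \<Longrightarrow>
        t - r < d \<Longrightarrow> s - t < d \<Longrightarrow>
        norm ((norm (x s - y))\<^sup>2 - (norm (x r - y))\<^sup>2 - (s - r) *\<^sub>R ?D) \<le> e * (s - r)"
      using vector_derivative_straddle[OF der _ \<open>0 < e\<close>] t0 by auto
    \<comment> \<open>As \<open>T y = y\<close>, the left side is the squared norm of
      \<open>T (x t) - T y\<close>; expanding it isolates the inner product.\<close>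
    have "(norm ((T (x t) - x t) + (x t - y)))\<^sup>2 \<le> (norm (x t - y))\<^sup>2"
      using nonexp[of "x t" y] y by (intro power_mono) (auto simp: Fix_def)
    moreover have "(norm (u + w))\<^sup>2 = (norm u)\<^sup>2 + 2 * (w \<bullet> u) + (norm w)\<^sup>2" for u w :: 'a
      by (simp add: power2_norm_eq_inner inner_add_left inner_add_right inner_commute[of u w])
    ultimately have "2 * ((x t - y) \<bullet> (T (x t) - x t)) \<le> - (residual t)\<^sup>2"
      by (smt (verit))
    then have "l t * (2 * ((x t - y) \<bullet> (T (x t) - x t))) \<le> l t * (- (residual t)\<^sup>2)"
      using l[OF t0] by (intro mult_left_mono) auto
    then have D: "?D \<le> - (l t * (residual t)\<^sup>2)" by simp
    have "(norm (x s - y))\<^sup>2 - (norm (x r - y))\<^sup>2 \<le> (- (l t * (residual t)\<^sup>2) + e) * (s - r)"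
      if "a \<le> r \<and> r \<le> t \<and> t \<le> s \<and> s \<le> b \<and> t - r < d \<and> s - t < d" for r s
    proof -
      have "(s - r) * ?D \<le> (s - r) * (- (l t * (residual t)\<^sup>2))"
        using D that by (intro mult_left_mono) auto
      then show ?thesis
        using d(2)[of r s] that assms(1) by (simp add: abs_le_iff algebra_simps)
    qed
    with d(1) show "\<exists>d>0. \<forall>r s. a \<le> r \<and> r \<le> t \<and> t \<le> s \<and> s \<le> b \<and> t - r < d \<and> s - t < d \<longrightarrow>
        (norm (x s - y))\<^sup>2 - (norm (x r - y))\<^sup>2 \<le> (- (l t * (residual t)\<^sup>2) + e) * (s - r)"
      by blast
  qed
  then show ?thesis by simp
qed

text \<open>Since the residual is antitone, \<open>residual t\<close> bounds the speed on
  \<open>{t..t+h}\<close> and hence the right difference quotients at \<open>t\<close>. This also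
  covers times in \<open>N\<close> where a derivative happens to exist.\<close>

lemma norm_derivative_le_residual:
  assumes "0 \<le> t" and D: "(x has_vector_derivative D) (at t within {0..})"
  shows "norm D \<le> residual t"
proof (rule field_le_epsilon)
  fix e :: real
  assume "0 < e"
  obtain d where d: "0 < d" "\<And>r s. r \<in> {0..} \<Longrightarrow> s \<in> {0..} \<Longrightarrow> r \<le> t \<Longrightarrow> t \<le> s \<Longrightarrow>
      t - r < d \<Longrightarrow> s - t < d \<Longrightarrow> norm (x s - x r - (s - r) *\<^sub>R D) \<le> e * (s - r)"
    using vector_derivative_straddle[OF D _ \<open>0 < e\<close>] assms(1) by (metis atLeast_iff)
  define h where "h = d / 2"
  have h: "0 < h" "h < d" using d(1) by (auto simp: h_def)
  have "norm (x (t + h) - x t - h *\<^sub>R D) \<le> e * h"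
    using d(2)[of t "t + h"] assms(1) h d(1) by simp
  moreover have "norm (x (t + h) - x t) \<le> residual t * h"
    using increment_norm_le[of t "t + h" "residual t"] residual_antitone[OF assms(1)] assms(1) h by simp
  moreover have "norm (h *\<^sub>R D) \<le> norm (x (t + h) - x t) + norm (x (t + h) - x t - h *\<^sub>R D)"
    using norm_triangle_ineq4[of "x (t + h) - x t" "x (t + h) - x t - h *\<^sub>R D"] by simp
  ultimately have "h * norm D \<le> h * (residual t + e)"
    using h by (simp add: algebra_simps)
  then show "norm D \<le> residual t + e"
    using h(1) by simp
qed

text \<open>Monotone convergence along \<open>{0..real k}\<close>, with the initial squared distance
  to \<open>y\<close> as a uniform bound.\<close>

lemma dissipation_integrable:
  assumes y: "y \<in> Fix T"
  shows "(\<lambda>t. l t * (residual t)\<^sup>2) integrable_on {0..}"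
proof -
  let ?h = "\<lambda>t. l t * (residual t)\<^sup>2"
  have int_eq: "integral {0..} (\<lambda>t. if t \<in> {0..real k} then ?h t else 0) = integral {0..real k} ?h" for k
  proof -
    have "{0..real k} \<inter> {0..} = {0..real k}" by auto
    then show ?thesis
      using Henstock_Kurzweil_Integration.integral_restrict_Int[of "{0..}" "{0..real k}" ?h] by simp
  qed
  have "?h integrable_on {0..} \<and>
    (\<lambda>k. integral {0..} (\<lambda>t. if t \<in> {0..real k} then ?h t else 0)) \<longlonglongrightarrow> integral {0..} ?h"
  proof (rule monotone_convergence_increasing)
    show "(\<lambda>t. if t \<in> {0..real k} then ?h t else 0) integrable_on {0..}" for k
    proof -
      have "{0..real k} \<inter> {0..} = {0..real k}" by auto
      then show ?thesis
        using dissipation_integrable_Icc[of 0 "real k"] integrable_restrict_Int[of "{0..real k}" ?h "{0..}"]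
        by simp
    qed
    show "(if t \<in> {0..real k} then ?h t else 0) \<le> (if t \<in> {0..real (Suc k)} then ?h t else 0)"
      if "t \<in> {0..}" for k t
      using dissipation_bounds(1)[of t] that by auto
    show "(\<lambda>k. if t \<in> {0..real k} then ?h t else 0) \<longlonglongrightarrow> ?h t" if "t \<in> {0..}" for t
    proof (rule tendsto_eventually)
      obtain n where "t \<le> real n" using real_arch_simple by blast
      then show "\<forall>\<^sub>F k in sequentially. (if t \<in> {0..real k} then ?h t else 0) = ?h t"
        using that by (intro eventually_sequentiallyI[of n]) auto
    qed
    have "\<bar>integral {0..real k} ?h\<bar> \<le> (norm (x 0 - y))\<^sup>2" for k
    proof -
      have "0 \<le> integral {0..real k} ?h"
        using dissipation_bounds(1)
        by (intro integral_nonneg dissipation_integrable_Icc) auto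
      moreover have "(norm (x (real k) - y))\<^sup>2 + integral {0..real k} ?h \<le> (norm (x 0 - y))\<^sup>2"
        using y by (intro sq_dist_fixed_point_decrease) auto
      moreover have "0 \<le> (norm (x (real k) - y))\<^sup>2" by simp
      ultimately show ?thesis by linarith
    qed
    then show "bounded (range (\<lambda>k. integral {0..} (\<lambda>t. if t \<in> {0..real k} then ?h t else 0)))"
      unfolding int_eq by (intro boundedI) auto
  qed
  then show ?thesis by blast
qed

text \<open>An antitone residual that does not tend to 0 stays above some \<open>e > 0\<close> at
  all times; then \<open>l\<close> is dominated by the dissipation divided by
  \<open>e\<^sup>2\<close> and would be integrable.\<close>

lemma residual_tendsto_0:
  assumes y: "y \<in> Fix T" and not_int: "\<not> l integrable_on {0..}"
  shows "((\<lambda>t. T (x t) - x t) \<longlongrightarrow> 0) at_top"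
proof (rule ccontr)
  assume "\<not> ?thesis"
  then obtain e where e: "0 < e" "\<not> (\<forall>\<^sub>F t in at_top. residual t < e)"
    by (auto simp: tendsto_iff dist_norm)
  have res: "e \<le> residual t" if "0 \<le> t" for t
  proof (rule ccontr)
    assume "\<not> e \<le> residual t"
    then have "residual s < e" if "t \<le> s" for s
      using residual_antitone[OF \<open>0 \<le> t\<close> that] by linarith
    with e(2) show False by (auto simp: eventually_at_top_linorder)
  qed
  have "l integrable_on {0..}"
  proof (rule measurable_bounded_by_integrable_imp_integrable[OF l_measurable])
    show "(\<lambda>t. (1 / e\<^sup>2) * (l t * (residual t)\<^sup>2)) integrable_on {0..}"
      by (intro integrable_on_mult_right dissipation_integrable[OF y])
    show "norm (l t) \<le> (1 / e\<^sup>2) * (l t * (residual t)\<^sup>2)" if "t \<in> {0..}" for t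
    proof -
      have "l t * e\<^sup>2 \<le> l t * (residual t)\<^sup>2"
        using res[of t] e(1) l[of t] that by (intro mult_left_mono power_mono) auto
      then show ?thesis
        using e(1) l[of t] that by (simp add: field_simps)
    qed
  qed simp
  with not_int show False ..
qed

end

text \<open>The first alternative is settled by \<open>l t * (1 - l t) \<le> l t\<close>, the second
  by comparison with a positive constant on a long interval.\<close>

lemma not_integrable_of_dissipation_condition:
  fixes l :: "real \<Rightarrow> real"
  assumes l: "\<And>t. 0 \<le> t \<Longrightarrow> l t \<in> {0..1}"
    and cond: "(\<integral>\<^sup>+ t. ennreal (l t * (1 - l t)) \<partial>lebesgue_on {0..}) = \<infinity> \<or> (INF t\<in>{0..}. l t) > 0"
  shows "\<not> l integrable_on {0..}"
proof
  assume int: "l integrable_on {0..}"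
  then have "l absolutely_integrable_on {0..}"
    using l by (intro nonnegative_absolutely_integrable_1) auto
  then have "integrable (lebesgue_on {0..}) l"
    by (rule absolutely_integrable_imp_integrable) simp
  then have "(\<integral>\<^sup>+ t. ennreal (norm (l t)) \<partial>lebesgue_on {0..}) < \<infinity>"
    by (simp add: integrable_iff_bounded)
  moreover have "(\<integral>\<^sup>+ t. ennreal (l t * (1 - l t)) \<partial>lebesgue_on {0..})
      \<le> (\<integral>\<^sup>+ t. ennreal (norm (l t)) \<partial>lebesgue_on {0..})"
    using l by (intro nn_integral_mono ennreal_leI) (auto simp: mult_left_le)
  ultimately have c: "(INF t\<in>{0..}. l t) > 0" (is "?c > 0")
    using cond by auto
  have le: "?c \<le> l t" if "0 \<le> t" for t
    using l that by (intro cINF_lower bdd_belowI[of _ 0]) auto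
  \<comment> \<open>Long enough for the constant lower bound alone to exceed the integral over
    \<open>{0..}\<close> by 1.\<close>
  define k where "k = (integral {0..} l + 1) / ?c"
  have "0 \<le> integral {0..} l"
    using int l by (intro integral_nonneg) auto
  then have k: "0 \<le> k" using c by (simp add: k_def)
  have int_k: "l integrable_on {0..k}"
    using integrable_on_subinterval[OF int, of 0 k] by auto
  have "integral {0..k} (\<lambda>_. ?c) \<le> integral {0..k} l"
    using le by (intro integral_le integrable_const_ivl int_k) auto
  also have "\<dots> \<le> integral {0..} l"
    using l by (intro integral_subset_le int int_k) auto
  finally have "k * ?c \<le> integral {0..} l"
    using k by simp
  then show False using c by (simp add: k_def)
qed

theorem theorem6:
  fixes T :: "'a::{real_inner, complete_space} \<Rightarrow> 'a"
    and l :: "real \<Rightarrow> real"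
    and x0 :: 'a
    and x :: "real \<Rightarrow> 'a"
  assumes "nonexpansive T"
    and "Fix T \<noteq> {}"
    and "l \<in> borel_measurable (lebesgue_on {0..})"
    and "\<And>t. 0 \<le> t \<Longrightarrow> l t \<in> {0..1}"
    and "(\<integral>\<^sup>+ t. ennreal (l t * (1 - l t)) \<partial>lebesgue_on {0..}) = \<infinity> \<or> (INF t\<in>{0..}. l t) > 0"
    and "strong_global_solution T l x0 x"
  shows "(bounded (x ` {0..}) \<and>
          set_integrable lebesgue {0..}
            (\<lambda>t. (norm (vector_derivative x (at t within {0..})))\<^sup>2)) \<and>
         ((\<lambda>t. T (x t) - x t) \<longlongrightarrow> 0) at_top \<and>
         ((\<lambda>t. vector_derivative x (at t within {0..})) \<longlongrightarrow> 0)
            (inf at_top (principal {t. 0 \<le> t \<and> x differentiable (at t within {0..})})) \<and>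
         (\<exists>p\<in>Fix T. weakly_tendsto x p at_top)"
proof -
  have "AE t in lebesgue. 0 \<le> t \<longrightarrow>
      (x has_vector_derivative l t *\<^sub>R (T (x t) - x t)) (at t within {0..})"
    using assms(6) by (simp add: strong_global_solution_def)
  then obtain N where "N \<in> null_sets lebesgue"
    and N': "\<And>t. t \<in> space lebesgue - N \<Longrightarrow> 0 \<le> t \<longrightarrow>
      (x has_vector_derivative l t *\<^sub>R (T (x t) - x t)) (at t within {0..})"
    by (elim AE_E3) blast
  then have N: "negligible N"
    by (simp add: negligible_iff_null_sets)
  interpret trajectory T l x N
    using assms(1,3,4,6) N N' by unfold_locales (auto simp: strong_global_solution_def)
  obtain y where y: "y \<in> Fix T" using assms(2) by blast
  have dist_antitone: "norm (x t - z) \<le> norm (x s - z)" if "z \<in> Fix T" "0 \<le> s" "s \<le> t" for z s t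
  proof (rule power2_le_imp_le)
    have "0 \<le> integral {s..t} (\<lambda>t. l t * (residual t)\<^sup>2)"
      using dissipation_bounds(1) that by (intro integral_nonneg dissipation_integrable_Icc) auto
    then show "(norm (x t - z))\<^sup>2 \<le> (norm (x s - z))\<^sup>2"
      using sq_dist_fixed_point_decrease[OF that(2,3,1)] by linarith
  qed simp
  have "norm (x t) \<le> norm (x 0 - y) + norm y" if "0 \<le> t" for t
    using dist_antitone[OF y _ that] norm_triangle_sub[of "x t" y] by simp
  then have "bounded (x ` {0..})"
    by (intro boundedI) auto
  moreover have "set_integrable lebesgue {0..} (\<lambda>t. (norm (vector_derivative x (at t within {0..})))\<^sup>2)"
  \<comment> \<open>Outside \<open>N\<close> the derivative is the right-hand side of the equation;
    values on the negligible \<open>N\<close> do not affect integrability.\<close>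
  proof (rule absolutely_integrable_spike[OF _ N])
    show "(\<lambda>t. (l t * residual t)\<^sup>2) absolutely_integrable_on {0..}"
    proof (rule measurable_bounded_by_integrable_imp_absolutely_integrable)
      have "residual \<in> borel_measurable (lebesgue_on {0..})"
        by (rule continuous_imp_measurable_on_sets_lebesgue[OF continuous_residual]) simp
      with l_measurable show "(\<lambda>t. (l t * residual t)\<^sup>2) \<in> borel_measurable (lebesgue_on {0..})"
        by measurable
      show "(\<lambda>t. l t * (residual t)\<^sup>2) integrable_on {0..}"
        by (rule dissipation_integrable[OF y])
      show "norm ((l t * residual t)\<^sup>2) \<le> l t * (residual t)\<^sup>2" if "t \<in> {0..}" for t
      proof -
        have "l t * l t \<le> l t" using l[of t] that by (simp add: mult_left_le)
        then have "(l t * l t) * (residual t)\<^sup>2 \<le> l t * (residual t)\<^sup>2"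
          by (rule mult_right_mono) simp
        then have "(l t * residual t)\<^sup>2 \<le> l t * (residual t)\<^sup>2"
          by (simp add: power2_eq_square mult_ac)
        then show ?thesis by (simp only: real_norm_def abs_power2)
      qed
    qed simp
    show "(norm (vector_derivative x (at t within {0..})))\<^sup>2 = (l t * residual t)\<^sup>2"
      if "t \<in> {0..} - N" for t
    proof -
      \<comment> \<open>Being a limit point of \<open>{0..}\<close>, including at
        \<open>t = 0\<close>, makes the derivative within \<open>{0..}\<close> unique.\<close>
      have "t islimpt {0..t + 1}" using that by simp
      then have "t islimpt {0..}" by (rule islimpt_subset) auto
      then have "vector_derivative x (at t within {0..}) = l t *\<^sub>R (T (x t) - x t)"
        using ode[of t] that by (intro vector_derivative_within) (auto simp: trivial_limit_within)
      then show ?thesis by (simp add: power_mult_distrib)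
    qed
  qed
  moreover have lim: "((\<lambda>t. T (x t) - x t) \<longlongrightarrow> 0) at_top"
    using residual_tendsto_0[OF y] not_integrable_of_dissipation_condition assms(4,5) by blast
  moreover have "((\<lambda>t. vector_derivative x (at t within {0..})) \<longlongrightarrow> 0)
      (inf at_top (principal {t. 0 \<le> t \<and> x differentiable (at t within {0..})}))"
  proof (rule Lim_null_comparison)
    show "\<forall>\<^sub>F t in inf at_top (principal {t. 0 \<le> t \<and> x differentiable (at t within {0..})}).
        norm (vector_derivative x (at t within {0..})) \<le> residual t"
      by (auto simp: eventually_inf_principal vector_derivative_works
          intro!: always_eventually norm_derivative_le_residual)
    show "(residual \<longlongrightarrow> 0) (inf at_top (principal {t. 0 \<le> t \<and> x differentiable (at t within {0..})}))"
      by (rule tendsto_mono[OF inf_le1 tendsto_norm_zero[OF lim]])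
  qed
  moreover have "\<exists>p\<in>Fix T. weakly_tendsto x p at_top"
  proof (rule opial_weak_convergence[OF T lim trivial_limit_at_top_linorder assms(2)])
    fix z
    assume z: "z \<in> Fix T"
    \<comment> \<open>A nonincreasing distance, bounded below by 0, converges to its
      infimum.\<close>
    define r where "r = (INF t\<in>{0..}. norm (x t - z))"
    have bdd: "bdd_below ((\<lambda>t. norm (x t - z)) ` {0..})"
      by (rule bdd_belowI[of _ 0]) auto
    have "((\<lambda>t. norm (x t - z)) \<longlongrightarrow> r) at_top"
    proof (rule tendstoI)
      fix e :: real
      assume "0 < e"
      have "\<exists>s\<in>{0..}. norm (x s - z) < r + e"
        unfolding r_def using \<open>0 < e\<close> cInf_lessD[of "(\<lambda>t. norm (x t - z)) ` {0..}" "(INF t\<in>{0..}. norm (x t - z)) + e"] by auto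
      then obtain s where s: "0 \<le> s" "norm (x s - z) < r + e" by auto
      have "dist (norm (x t - z)) r < e" if "s \<le> t" for t
      proof -
        have "r \<le> norm (x t - z)"
          unfolding r_def using bdd s(1) that by (intro cINF_lower) auto
        then show ?thesis
          using dist_antitone[OF z s(1) that] s(2) by (simp add: dist_real_def)
      qed
      then show "\<forall>\<^sub>F t in at_top. dist (norm (x t - z)) r < e"
        by (rule eventually_at_top_linorderI)
    qed
    then show "\<exists>r. ((\<lambda>t. norm (x t - z)) \<longlongrightarrow> r) at_top" by blast
  qed
  ultimately show ?thesis by blast
qed

end
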